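(* Let $(M_n)_{n\ge0}$ be a nonanalytic weight sequence. Suppose $\phi$ is analytic on $\bar\Delta$, $\phi:\bar\Delta\to\bar\Delta$, $\phi\in D(\bar\Delta,M)$ and $\phi$ is not an inner function. If $\phi$ has a fixed point in $\Delta$ and $\phi_N$ has a fixed point on $\bar\Delta\setminus\Delta$ for some positive integer $N$, then $\phi$ does not induce an endomorphism of $D(\bar\Delta,M)$.
   Context: $\Delta$ is the open unit disc in $\mathbb{C}$ and $\bar\Delta$ the closed unit disc. A self-map $\phi$ of $\bar\Delta$ is analytic on $\bar\Delta$ if it extends to an analytic function on a neighborhood of $\bar\Delta$. $\phi_N$ denotes the $N$-th iterate of $\phi$ ($N$-fold composition). An inner function is an analytic function $\phi$ on $\Delta$ with $|\phi(z)|\le1$ on $\Delta$ and $|\phi(e^{i\theta})|=1$ for almost all $\theta$. A function $f:\bar\Delta\to\mathbb{C}$ is complex-differentiable at $a\in\bar\Delta$ if $f'(a)=\lim_{z\to a,\ z\in\bar\Delta}\frac{f(z)-f(a)}{z-a}$ exists; higher derivatives $f^{(n)}$ are defined by iteration, and $D^\infty(\bar\Delta)$ is the set of infinitely complex-differentiable functions on $\bar\Delta$. $\|\cdot\|_\infty$ is the sup norm over $\bar\Delta$. A weight sequence is a sequence $(M_n)_{n\ge0}$ of positive numbers with $M_0=1$ and $\binom{m+n}{n}\le\frac{M_{m+n}}{M_mM_n}$ for all $m,n\ge0$. It is nonanalytic if $\lim_{n\to\infty}(n!/M_n)^{1/n}=0$. Define $D(\bar\Delta,M)=\{f\in D^\infty(\bar\Delta):\|f\|_{D(\bar\Delta,M)}=\sum_{n=0}^\infty\frac{\|f^{(n)}\|_\infty}{M_n}<\infty\}$,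 a Banach algebra under pointwise operations. A map $\psi:\bar\Delta\to\bar\Delta$ induces an endomorphism of $D(\bar\Delta,M)$ if $f\circ\psi\in D(\bar\Delta,M)$ for all $f\in D(\bar\Delta,M)$. *)

theory Defs
  imports "HOL-Complex_Analysis.Complex_Analysis"
begin

(* A function on the closed unit disc is represented by a total function complex => complex
   of which only the values on the disc matter. *)

abbreviation udisc :: "complex set" where "udisc \<equiv> ball 0 1"

abbreviation cdisc :: "complex set" where "cdisc \<equiv> cball 0 1"

definition analytic_on_cdisc :: "(complex \<Rightarrow> complex) \<Rightarrow> bool" where
  "analytic_on_cdisc f \<longleftrightarrow>
     (\<exists>U g. open U \<and> cdisc \<subseteq> U \<and> g analytic_on U \<and> (\<forall>z\<in>cdisc. g z = f z))"

(* The boundary value at a point of the circle is the radial limit; for a function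
   continuous on the closed disc this is just its value there. *)
definition inner_function :: "(complex \<Rightarrow> complex) \<Rightarrow> bool" where
  "inner_function f \<longleftrightarrow>
     f analytic_on udisc \<and> (\<forall>z\<in>udisc. norm (f z) \<le> 1) \<and>
     (AE t in lebesgue_on {0..2 * pi}.
        \<exists>l. ((\<lambda>r. f (of_real r * cis t)) \<longlongrightarrow> l) (at_left 1) \<and> norm l = 1)"

(* The limit of difference quotients is taken within the closed disc, also at boundary
   points. Unspecified where the derivative does not exist, and outside the disc. *)
definition cdisc_deriv :: "(complex \<Rightarrow> complex) \<Rightarrow> complex \<Rightarrow> complex" where
  "cdisc_deriv f a = (THE D. (f has_field_derivative D) (at a within cdisc))"

definition D_infinity :: "(complex \<Rightarrow> complex) set" where
  "D_infinity =
     {f. \<forall>n. \<forall>a\<in>cdisc. (cdisc_deriv ^^ n) f field_differentiable (at a within cdisc)}"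

(* Only applied to functions continuous on the disc, where the supremum is finite. *)
definition cdisc_sup_norm :: "(complex \<Rightarrow> complex) \<Rightarrow> real" where
  "cdisc_sup_norm f = (SUP z\<in>cdisc. norm (f z))"

definition weight_sequence :: "(nat \<Rightarrow> real) \<Rightarrow> bool" where
  "weight_sequence M \<longleftrightarrow>
     (\<forall>n. M n > 0) \<and> M 0 = 1 \<and>
     (\<forall>m n. real ((m + n) choose n) \<le> M (m + n) / (M m * M n))"

definition nonanalytic_weight :: "(nat \<Rightarrow> real) \<Rightarrow> bool" where
  "nonanalytic_weight M \<longleftrightarrow>
     weight_sequence M \<and> (\<lambda>n. root n (fact n / M n)) \<longlonglongrightarrow> 0"

definition D_space :: "(nat \<Rightarrow> real) \<Rightarrow> (complex \<Rightarrow> complex) set" where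
  "D_space M = {f \<in> D_infinity. summable (\<lambda>n. cdisc_sup_norm ((cdisc_deriv ^^ n) f) / M n)}"

definition induces_endomorphism :: "(nat \<Rightarrow> real) \<Rightarrow> (complex \<Rightarrow> complex) \<Rightarrow> bool" where
  "induces_endomorphism M \<psi> \<longleftrightarrow> (\<forall>f \<in> D_space M. f \<circ> \<psi> \<in> D_space M)"

end

theory Submission imports Defs begin

text \<open>
  Suppose that \<open>\<phi>\<close> induces an endomorphism.  Then so does \<open>\<psi> = \<phi> ^^ N\<close>, which has an interior
  fixed point \<open>b\<close> and a boundary fixed point \<open>a\<close>.  The contradiction comes from the multiplier
  \<open>l\<close>, the derivative of \<open>\<psi>\<close> at \<open>a\<close>.

  First, \<open>norm l > 1\<close> (\<open>boundary_fixed_point_repelling\<close>).  As \<open>\<phi>\<close> is not inner, it maps some point of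
  the circle into the open disc, hence so does \<open>\<psi>\<close>, since \<open>\<phi>\<close> maps the open disc into itself, and \<open>\<psi>\<close> is not an automorphism.
  The Schwarz lemma at \<open>b\<close>, sharpened by the Schwarz--Pick inequality, then shows that \<open>\<psi>\<close> expands
  radially at \<open>a\<close>.

  Second, composition with \<open>\<psi>\<close> is a bounded operator on the space, with norm at most \<open>K\<close>, say
  (\<open>endomorphism_bounded\<close>).  This is a closed graph argument, carried out by means of completeness of
  the space (\<open>D_space_complete\<close>) and the uniform boundedness principle
  (\<open>D_space_uniform_boundedness\<close>), applied to the partial sums of the norm of \<open>f \<circ> \<psi>\<close>.

  Third, these two facts are incompatible (\<open>repelling_fixed_point_not_endomorphism\<close>).  For
  \<open>f z = (z - a) ^ n\<close>, the \<open>n\<close>-th derivative of \<open>f \<circ> \<psi> ^^ k\<close> at \<open>a\<close> is \<open>fact n * l ^ (n * k)\<close>,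
  because the lower derivatives of \<open>f\<close> vanish there.  Therefore
  \<open>fact n * norm l ^ (n * k) / M n \<le> K ^ k * D_norm M f\<close> for all \<open>k\<close>, which fails for large \<open>k\<close>
  once \<open>n\<close> is such that \<open>norm l ^ n > K\<close>.
\<close>

section \<open>Derivatives within the closed disc\<close>

text \<open>The \<open>n\<close>-th derivative, formed within the closed disc; only its values there matter.\<close>

abbreviation cdisc_higher_deriv :: "nat \<Rightarrow> (complex \<Rightarrow> complex) \<Rightarrow> complex \<Rightarrow> complex" where
  "cdisc_higher_deriv n f \<equiv> (cdisc_deriv ^^ n) f"

lemma cdisc_limit_point:
  fixes a :: complex
  assumes "a \<in> cdisc" shows "at a within cdisc \<noteq> bot"
proof -
  have "S \<noteq> {x}" if "0 \<in> S" "1 \<in> S" for S :: "complex set" and x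
    using that by auto
  hence "a islimpt cdisc"
    using assms by (intro connected_imp_perfect) auto
  thus ?thesis by (simp add: trivial_limit_within)
qed

lemma cdisc_deriv_eqI:
  assumes "a \<in> cdisc" "(f has_field_derivative D) (at a within cdisc)"
  shows "cdisc_deriv f a = D"
  unfolding cdisc_deriv_def
proof (rule the_equality)
  fix D' assume "(f has_field_derivative D') (at a within cdisc)"
  thus "D' = D"
    using assms(2) tendsto_unique[OF cdisc_limit_point[OF assms(1)]]
    unfolding has_field_derivative_iff by blast
qed fact

lemma D_infinity_has_field_derivative:
  assumes "f \<in> D_infinity" "a \<in> cdisc"
  shows "(cdisc_higher_deriv n f has_field_derivative cdisc_higher_deriv (Suc n) f a) (at a within cdisc)"
proof -
  obtain D where D: "(cdisc_higher_deriv n f has_field_derivative D) (at a within cdisc)"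
    using assms unfolding D_infinity_def field_differentiable_def by blast
  with cdisc_deriv_eqI[OF assms(2) D] show ?thesis by simp
qed

text \<open>An iterated derivative is identified by exhibiting a sequence of functions each of which is
  the derivative of the preceding one.\<close>

lemma
  assumes F0: "\<And>z. z \<in> cdisc \<Longrightarrow> F 0 z = f z"
    and F: "\<And>n z. z \<in> cdisc \<Longrightarrow> (F n has_field_derivative F (Suc n) z) (at z within cdisc)"
  shows cdisc_higher_deriv_eqI: "z \<in> cdisc \<Longrightarrow> cdisc_higher_deriv n f z = F n z"
    and D_infinityI: "f \<in> D_infinity"
proof -
  have transfer: "(g has_field_derivative F (Suc n) z) (at z within cdisc)"
    if "\<And>z. z \<in> cdisc \<Longrightarrow> g z = F n z" "z \<in> cdisc" for g n z
    by (rule has_field_derivative_transform_within[OF F[OF that(2)] zero_less_one])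
       (use that in auto)
  have eq: "cdisc_higher_deriv n f z = F n z" if "z \<in> cdisc" for n z
    using that
  proof (induction n arbitrary: z)
    case (Suc n)
    show ?case
      using cdisc_deriv_eqI[OF Suc.prems transfer[OF Suc.IH Suc.prems]] by simp
  qed (simp add: F0)
  thus "z \<in> cdisc \<Longrightarrow> cdisc_higher_deriv n f z = F n z" .
  show "f \<in> D_infinity"
    using transfer[OF eq] unfolding D_infinity_def field_differentiable_def by blast
qed

lemma D_infinity_continuous_on:
  assumes "f \<in> D_infinity" shows "continuous_on cdisc (cdisc_higher_deriv n f)"
  using D_infinity_has_field_derivative[OF assms]
  by (meson DERIV_continuous continuous_on_eq_continuous_within)

lemma
  assumes "f \<in> D_infinity" "g \<in> D_infinity"
  shows D_infinity_add: "(\<lambda>z. f z + g z) \<in> D_infinity"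
    and cdisc_higher_deriv_add: "z \<in> cdisc \<Longrightarrow>
      cdisc_higher_deriv n (\<lambda>z. f z + g z) z = cdisc_higher_deriv n f z + cdisc_higher_deriv n g z"
proof -
  let ?F = "\<lambda>n z. cdisc_higher_deriv n f z + cdisc_higher_deriv n g z"
  have F: "(?F n has_field_derivative ?F (Suc n) z) (at z within cdisc)" if "z \<in> cdisc" for n z
    by (intro DERIV_add D_infinity_has_field_derivative assms that)
  show "(\<lambda>z. f z + g z) \<in> D_infinity"
    by (rule D_infinityI[of ?F]) (use F in auto)
  show "z \<in> cdisc \<Longrightarrow> cdisc_higher_deriv n (\<lambda>z. f z + g z) z = ?F n z"
    by (rule cdisc_higher_deriv_eqI[of ?F]) (use F in auto)
qed

lemma
  assumes "f \<in> D_infinity"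
  shows D_infinity_scale: "(\<lambda>z. c * f z) \<in> D_infinity"
    and cdisc_higher_deriv_scale: "z \<in> cdisc \<Longrightarrow>
      cdisc_higher_deriv n (\<lambda>z. c * f z) z = c * cdisc_higher_deriv n f z"
proof -
  let ?F = "\<lambda>n z. c * cdisc_higher_deriv n f z"
  have F: "(?F n has_field_derivative ?F (Suc n) z) (at z within cdisc)" if "z \<in> cdisc" for n z
    by (intro DERIV_cmult D_infinity_has_field_derivative assms that)
  show "(\<lambda>z. c * f z) \<in> D_infinity"
    by (rule D_infinityI[of ?F]) (use F in auto)
  show "z \<in> cdisc \<Longrightarrow> cdisc_higher_deriv n (\<lambda>z. c * f z) z = ?F n z"
    by (rule cdisc_higher_deriv_eqI[of ?F]) (use F in auto)
qed

lemma
  shows D_infinity_zero: "(\<lambda>z. 0) \<in> D_infinity"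
    and cdisc_higher_deriv_zero: "z \<in> cdisc \<Longrightarrow> cdisc_higher_deriv n (\<lambda>z. 0) z = 0"
  using D_infinityI[of "\<lambda>n z. 0" "\<lambda>z. 0"] cdisc_higher_deriv_eqI[of "\<lambda>n z. 0" "\<lambda>z. 0"] by auto


section \<open>The supremum norm\<close>

lemma cdisc_sup_norm_cong:
  assumes "\<And>z. z \<in> cdisc \<Longrightarrow> f z = g z"
  shows "cdisc_sup_norm f = cdisc_sup_norm g"
  unfolding cdisc_sup_norm_def using assms by (intro SUP_cong) auto

lemma cdisc_sup_norm_le:
  assumes "\<And>z. z \<in> cdisc \<Longrightarrow> norm (f z) \<le> B"
  shows "cdisc_sup_norm f \<le> B"
  unfolding cdisc_sup_norm_def by (rule cSUP_least) (use assms in auto)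

lemma norm_le_cdisc_sup_norm:
  assumes "continuous_on cdisc f" "z \<in> cdisc"
  shows "norm (f z) \<le> cdisc_sup_norm f"
proof -
  have "bdd_above ((\<lambda>z. norm (f z)) ` cdisc)"
    by (intro bounded_imp_bdd_above compact_imp_bounded compact_continuous_image
        continuous_intros assms) auto
  thus ?thesis
    unfolding cdisc_sup_norm_def using assms(2) by (rule cSUP_upper2) auto
qed

lemma cdisc_sup_norm_nonneg:
  assumes "continuous_on cdisc f" shows "cdisc_sup_norm f \<ge> 0"
  by (rule order_trans[OF norm_ge_zero norm_le_cdisc_sup_norm[OF assms, of 0]]) simp

lemma cdisc_sup_norm_add:
  assumes "continuous_on cdisc f" "continuous_on cdisc g"
  shows "cdisc_sup_norm (\<lambda>z. f z + g z) \<le> cdisc_sup_norm f + cdisc_sup_norm g"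
  using assms
  by (intro cdisc_sup_norm_le order_trans[OF norm_triangle_ineq] add_mono norm_le_cdisc_sup_norm)

lemma cdisc_sup_norm_scale:
  assumes "continuous_on cdisc f"
  shows "cdisc_sup_norm (\<lambda>z. c * f z) = norm c * cdisc_sup_norm f"
proof (cases "c = 0")
  case True
  thus ?thesis by (simp add: cdisc_sup_norm_def)
next
  case False
  have le: "cdisc_sup_norm (\<lambda>z. c * f z) \<le> norm c * cdisc_sup_norm f"
    if "continuous_on cdisc f" for c f
    using norm_le_cdisc_sup_norm[OF that]
    by (intro cdisc_sup_norm_le) (auto simp: norm_mult intro: mult_left_mono)
  have "cdisc_sup_norm f \<le> norm (inverse c) * cdisc_sup_norm (\<lambda>z. c * f z)"
    using le[of "\<lambda>z. c * f z" "inverse c"] assms False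
    by (simp add: continuous_intros flip: mult.assoc)
  with le[OF assms, of c] False show ?thesis
    by (simp add: norm_inverse norm_divide field_simps)
qed

text \<open>The supremum norm of the \<open>n\<close>-th derivative, a seminorm on \<open>D_infinity\<close>.\<close>

abbreviation higher_sup_norm :: "nat \<Rightarrow> (complex \<Rightarrow> complex) \<Rightarrow> real" where
  "higher_sup_norm n f \<equiv> cdisc_sup_norm (cdisc_higher_deriv n f)"

lemma norm_le_higher_sup_norm:
  assumes "f \<in> D_infinity" "z \<in> cdisc"
  shows "norm (cdisc_higher_deriv n f z) \<le> higher_sup_norm n f"
  by (intro norm_le_cdisc_sup_norm D_infinity_continuous_on assms)

lemma higher_sup_norm_nonneg: "f \<in> D_infinity \<Longrightarrow> higher_sup_norm n f \<ge> 0"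
  by (intro cdisc_sup_norm_nonneg D_infinity_continuous_on)

lemma higher_sup_norm_zero: "higher_sup_norm n (\<lambda>z. 0) = 0"
proof -
  have "higher_sup_norm n (\<lambda>z. 0) = cdisc_sup_norm (\<lambda>z. 0)"
    by (rule cdisc_sup_norm_cong) (rule cdisc_higher_deriv_zero)
  thus ?thesis by (simp add: cdisc_sup_norm_def)
qed

lemma higher_sup_norm_add:
  assumes "f \<in> D_infinity" "g \<in> D_infinity"
  shows "higher_sup_norm n (\<lambda>z. f z + g z) \<le> higher_sup_norm n f + higher_sup_norm n g"
proof -
  have "higher_sup_norm n (\<lambda>z. f z + g z)
      = cdisc_sup_norm (\<lambda>z. cdisc_higher_deriv n f z + cdisc_higher_deriv n g z)"
    by (rule cdisc_sup_norm_cong) (rule cdisc_higher_deriv_add[OF assms])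
  thus ?thesis
    using cdisc_sup_norm_add assms by (simp add: D_infinity_continuous_on)
qed

lemma higher_sup_norm_scale:
  assumes "f \<in> D_infinity"
  shows "higher_sup_norm n (\<lambda>z. c * f z) = norm c * higher_sup_norm n f"
proof -
  have "higher_sup_norm n (\<lambda>z. c * f z) = cdisc_sup_norm (\<lambda>z. c * cdisc_higher_deriv n f z)"
    by (rule cdisc_sup_norm_cong) (rule cdisc_higher_deriv_scale[OF assms])
  thus ?thesis
    using cdisc_sup_norm_scale assms by (simp add: D_infinity_continuous_on)
qed


section \<open>The normed space of the weight sequence and its completeness\<close>

text \<open>The norm of the space.  On functions outside of it, the series has no specified value.\<close>

definition D_norm :: "(nat \<Rightarrow> real) \<Rightarrow> (complex \<Rightarrow> complex) \<Rightarrow> real" where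
  "D_norm M f = (\<Sum>n. higher_sup_norm n f / M n)"

lemma D_space_imp_D_infinity: "f \<in> D_space M \<Longrightarrow> f \<in> D_infinity"
  by (simp add: D_space_def)

context
  fixes M :: "nat \<Rightarrow> real"
  assumes M_pos: "\<And>n. M n > 0"
begin

lemma
  assumes "f \<in> D_infinity" "\<And>J. (\<Sum>n<J. higher_sup_norm n f / M n) \<le> B"
  shows D_spaceI: "f \<in> D_space M" and D_norm_le: "D_norm M f \<le> B"
proof -
  have nonneg: "higher_sup_norm n f / M n \<ge> 0" for n
    using higher_sup_norm_nonneg[OF assms(1)] M_pos[of n] by simp
  have "summable (\<lambda>n. higher_sup_norm n f / M n)"
    by (rule summableI_nonneg_bounded[of _ B]) (use nonneg assms in auto)
  thus "f \<in> D_space M" "D_norm M f \<le> B"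
    using assms unfolding D_space_def D_norm_def by (auto intro: suminf_le_const)
qed

lemma sum_le_D_norm:
  assumes "f \<in> D_space M"
  shows "(\<Sum>n<J. higher_sup_norm n f / M n) \<le> D_norm M f"
  using assms higher_sup_norm_nonneg M_pos unfolding D_space_def D_norm_def
  by (auto intro!: sum_le_suminf divide_nonneg_pos)

lemma higher_sup_norm_le_D_norm:
  assumes "f \<in> D_space M"
  shows "higher_sup_norm n f \<le> M n * D_norm M f"
proof -
  have "higher_sup_norm n f / M n \<le> (\<Sum>k<Suc n. higher_sup_norm k f / M k)"
    using higher_sup_norm_nonneg[OF D_space_imp_D_infinity[OF assms]] M_pos
    by (intro member_le_sum) (auto intro: divide_nonneg_pos)
  also have "\<dots> \<le> D_norm M f" by (rule sum_le_D_norm[OF assms])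
  finally show ?thesis using M_pos[of n] by (simp add: field_simps)
qed

lemma D_norm_nonneg: "f \<in> D_space M \<Longrightarrow> D_norm M f \<ge> 0"
  using sum_le_D_norm[of f 0] by simp

lemma D_space_add:
  assumes "f \<in> D_space M" "g \<in> D_space M"
  shows "(\<lambda>z. f z + g z) \<in> D_space M"
proof -
  note fg = assms[THEN D_space_imp_D_infinity]
  have le: "(\<Sum>n<J. higher_sup_norm n (\<lambda>z. f z + g z) / M n) \<le> D_norm M f + D_norm M g" for J
  proof -
    have "(\<Sum>n<J. higher_sup_norm n (\<lambda>z. f z + g z) / M n)
        \<le> (\<Sum>n<J. (higher_sup_norm n f + higher_sup_norm n g) / M n)"
      using higher_sup_norm_add[OF fg] M_pos by (intro sum_mono divide_right_mono) (auto intro: less_imp_le)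
    also have "\<dots> = (\<Sum>n<J. higher_sup_norm n f / M n) + (\<Sum>n<J. higher_sup_norm n g / M n)"
      by (simp add: add_divide_distrib sum.distrib)
    also have "\<dots> \<le> D_norm M f + D_norm M g"
      by (intro add_mono sum_le_D_norm assms)
    finally show ?thesis .
  qed
  show ?thesis
    by (rule D_spaceI[OF D_infinity_add[OF fg] le])
qed

lemma
  assumes "f \<in> D_space M"
  shows D_space_scale: "(\<lambda>z. c * f z) \<in> D_space M"
    and D_norm_scale: "D_norm M (\<lambda>z. c * f z) = norm c * D_norm M f"
proof -
  have eq: "(\<lambda>n. higher_sup_norm n (\<lambda>z. c * f z) / M n) = (\<lambda>n. norm c * (higher_sup_norm n f / M n))"
    using higher_sup_norm_scale[OF D_space_imp_D_infinity[OF assms]] by simp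
  have summable: "summable (\<lambda>n. higher_sup_norm n f / M n)"
    using assms by (simp add: D_space_def)
  show "(\<lambda>z. c * f z) \<in> D_space M"
    using D_infinity_scale[OF D_space_imp_D_infinity[OF assms]] summable_mult[OF summable]
    unfolding D_space_def by (simp add: eq)
  show "D_norm M (\<lambda>z. c * f z) = norm c * D_norm M f"
    unfolding D_norm_def eq by (rule suminf_mult[OF summable])
qed

lemma D_space_zero: "(\<lambda>z. 0) \<in> D_space M"
  by (rule D_spaceI[where B = 0]) (simp_all add: D_infinity_zero higher_sup_norm_zero)

lemma
  assumes "\<And>k. g k \<in> D_space M"
  shows D_space_sum: "(\<lambda>z. \<Sum>k<m. g k z) \<in> D_space M"
    and cdisc_higher_deriv_sum: "z \<in> cdisc \<Longrightarrow>
      cdisc_higher_deriv n (\<lambda>z. \<Sum>k<(m::nat). g k z) z = (\<Sum>k<m. cdisc_higher_deriv n (g k) z)"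
proof -
  show D: "(\<lambda>z. \<Sum>k<m. g k z) \<in> D_space M" for m
    by (induction m) (auto intro: D_space_zero D_space_add assms)
  show "z \<in> cdisc \<Longrightarrow>
    cdisc_higher_deriv n (\<lambda>z. \<Sum>k<m. g k z) z = (\<Sum>k<m. cdisc_higher_deriv n (g k) z)"
    by (induction m)
       (simp_all add: cdisc_higher_deriv_zero cdisc_higher_deriv_add[OF D[THEN D_space_imp_D_infinity]
          assms[THEN D_space_imp_D_infinity]])
qed

text \<open>Completeness, in the form that absolutely convergent series converge: differentiating
  the series term by term is legitimate since every differentiated series converges uniformly
  on the (convex) disc.\<close>

lemma D_space_complete:
  assumes g: "\<And>k. g k \<in> D_space M" and summable: "summable (\<lambda>k. D_norm M (g k))"
  obtains f where "f \<in> D_space M"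
    "\<And>m. (\<lambda>z. f z - (\<Sum>k<m. g k z)) \<in> D_space M"
    "\<And>m. D_norm M (\<lambda>z. f z - (\<Sum>k<m. g k z)) \<le> (\<Sum>k. D_norm M (g (k + m)))"
proof -
  note g' = g[THEN D_space_imp_D_infinity]
  define G where "G n z = (\<Sum>k. cdisc_higher_deriv n (g k) z)" for n z
  have bound: "norm (cdisc_higher_deriv n (g k) z) \<le> M n * D_norm M (g k)" if "z \<in> cdisc" for n k z
    using norm_le_higher_sup_norm[OF g' that] higher_sup_norm_le_D_norm[OF g] by (rule order_trans)
  have summable_deriv: "summable (\<lambda>k. cdisc_higher_deriv n (g k) z)" if "z \<in> cdisc" for n z
    by (rule summable_comparison_test'[OF summable_mult[OF summable]]) (rule bound[OF that])
  have uniform: "uniform_limit cdisc (\<lambda>m z. \<Sum>k<m. cdisc_higher_deriv n (g k) z) (G n) sequentially" for n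
    unfolding G_def by (rule Weierstrass_m_test[OF bound summable_mult[OF summable]])
  have G: "(G n has_field_derivative G (Suc n) z) (at z within cdisc)" if z: "z \<in> cdisc" for n z
  proof -
    obtain h where h: "\<And>z. z \<in> cdisc \<Longrightarrow> (\<lambda>k. cdisc_higher_deriv n (g k) z) sums h z"
      "\<And>z. z \<in> cdisc \<Longrightarrow> (h has_field_derivative G (Suc n) z) (at z within cdisc)"
      using has_field_derivative_series[OF convex_cball D_infinity_has_field_derivative[OF g']
          uniform z summable_deriv[OF z]] by blast
    show ?thesis
      by (rule has_field_derivative_transform_within[OF h(2)[OF z] zero_less_one z])
         (simp add: G_def sums_unique[OF h(1)])
  qed
  have G_D_infinity: "G 0 \<in> D_infinity" and deriv_G: "\<And>n z. z \<in> cdisc \<Longrightarrow> cdisc_higher_deriv n (G 0) z = G n z"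
    using D_infinityI[of G "G 0"] cdisc_higher_deriv_eqI[of G "G 0"] G by auto
  define R where "R m z = G 0 z - (\<Sum>k<m. g k z)" for m z
  note S = D_space_sum[of g, OF g]
  have R_eq: "R m = (\<lambda>z. G 0 z + (-1) * (\<Sum>k<m. g k z))" for m
    by (simp add: R_def fun_eq_iff)
  note S' = D_infinity_scale[OF S[THEN D_space_imp_D_infinity], of "-1"]
  have R_D_infinity: "R m \<in> D_infinity" for m
    unfolding R_eq using G_D_infinity S' by (rule D_infinity_add)
  have summable_tail: "summable (\<lambda>k. D_norm M (g (k + m)))" for m
    using summable by (rule summable_ignore_initial_segment)
  have tail_summable: "summable (\<lambda>k. higher_sup_norm n (g (k + m)))" for n m
    by (rule summable_comparison_test'[OF summable_mult[OF summable_tail, of "M n"]])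
       (use higher_sup_norm_le_D_norm[OF g] higher_sup_norm_nonneg[OF g'] in auto)
  have R_deriv: "cdisc_higher_deriv n (R m) z = (\<Sum>k. cdisc_higher_deriv n (g (k + m)) z)"
    if z: "z \<in> cdisc" for n m z
  proof -
    have "cdisc_higher_deriv n (R m) z = G n z - (\<Sum>k<m. cdisc_higher_deriv n (g k) z)"
      unfolding R_eq cdisc_higher_deriv_add[OF G_D_infinity S' z]
        cdisc_higher_deriv_scale[OF S[THEN D_space_imp_D_infinity] z]
        cdisc_higher_deriv_sum[OF g z] deriv_G[OF z] by simp
    thus ?thesis
      unfolding G_def by (simp add: suminf_minus_initial_segment[OF summable_deriv[OF z]])
  qed
  have R_le: "higher_sup_norm n (R m) \<le> (\<Sum>k. higher_sup_norm n (g (k + m)))" for n m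
  proof (rule cdisc_sup_norm_le)
    fix z :: complex assume z: "z \<in> cdisc"
    show "norm (cdisc_higher_deriv n (R m) z) \<le> (\<Sum>k. higher_sup_norm n (g (k + m)))"
      unfolding R_deriv[OF z]
      by (rule norm_suminf_le[OF norm_le_higher_sup_norm[OF g' z] tail_summable])
  qed
  have partial: "(\<Sum>n<J. higher_sup_norm n (R m) / M n) \<le> (\<Sum>k. D_norm M (g (k + m)))" for J m
  proof -
    have "(\<Sum>n<J. higher_sup_norm n (R m) / M n) \<le> (\<Sum>n<J. (\<Sum>k. higher_sup_norm n (g (k + m))) / M n)"
      using R_le M_pos by (intro sum_mono divide_right_mono) (auto intro: less_imp_le)
    also have "\<dots> = (\<Sum>n<J. (\<Sum>k. higher_sup_norm n (g (k + m)) / M n))"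
      by (simp add: suminf_divide[OF tail_summable])
    also have "\<dots> = (\<Sum>k. \<Sum>n<J. higher_sup_norm n (g (k + m)) / M n)"
      by (rule suminf_sum[symmetric]) (rule summable_divide[OF tail_summable])
    also have "\<dots> \<le> (\<Sum>k. D_norm M (g (k + m)))"
      using sum_le_D_norm[OF g] summable_tail
      by (intro suminf_le summable_sum summable_divide[OF tail_summable])
    finally show ?thesis .
  qed
  have "R m \<in> D_space M" and "D_norm M (R m) \<le> (\<Sum>k. D_norm M (g (k + m)))" for m
    using D_spaceI[OF R_D_infinity partial] D_norm_le[OF R_D_infinity partial] by auto
  from this(1)[of 0] this show ?thesis
    using that[of "G 0"] unfolding R_def by auto
qed

end


section \<open>Uniform boundedness and composition operators\<close>

text \<open>The uniform boundedness principle for a pointwise bounded sequence of continuous seminorms.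
  The proof is a gliding hump: with \<open>\<kappa> J\<close> the norm of \<open>p J\<close>, nearly norming vectors \<open>u n\<close> of
  size \<open>3 ^ -n\<close> for seminorms of norm at least \<open>4 ^ n\<close> are added or subtracted one after the other,
  the sign chosen such that no cancellation occurs in the seminorm at hand.  The later terms are too
  small to spoil this.\<close>

lemma D_space_uniform_boundedness:
  fixes p :: "nat \<Rightarrow> (complex \<Rightarrow> complex) \<Rightarrow> real"
  assumes M_pos: "\<And>n. M n > 0"
    and p_add: "\<And>J f g. f \<in> D_space M \<Longrightarrow> g \<in> D_space M \<Longrightarrow> p J (\<lambda>z. f z + g z) \<le> p J f + p J g"
    and p_scale: "\<And>J f c. f \<in> D_space M \<Longrightarrow> p J (\<lambda>z. c * f z) = norm c * p J f"
    and continuous: "\<And>J. \<exists>C. \<forall>f\<in>D_space M. p J f \<le> C * D_norm M f"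
    and pointwise: "\<And>f. f \<in> D_space M \<Longrightarrow> \<exists>B. \<forall>J. p J f \<le> B"
  shows "\<exists>K>0. \<forall>f\<in>D_space M. \<forall>J. p J f \<le> K * D_norm M f"
proof -
  define \<kappa> where "\<kappa> J = (SUP f\<in>{f \<in> D_space M. D_norm M f \<le> 1}. p J f)" for J
  have D_norm_zero: "D_norm M (\<lambda>z. 0) = 0"
    using D_norm_scale[OF M_pos D_space_zero[OF M_pos], where c = 0] by simp
  have ball_nonempty: "{f \<in> D_space M. D_norm M f \<le> 1} \<noteq> {}"
    using D_space_zero[of M, OF M_pos] D_norm_zero by auto
  have bdd: "bdd_above (p J ` {f \<in> D_space M. D_norm M f \<le> 1})" for J
  proof -
    obtain C where C: "\<And>f. f \<in> D_space M \<Longrightarrow> p J f \<le> C * D_norm M f"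
      using continuous[of J] by blast
    have "p J f \<le> \<bar>C\<bar>" if "f \<in> D_space M" "D_norm M f \<le> 1" for f
    proof -
      have "p J f \<le> \<bar>C\<bar> * D_norm M f"
        using C[OF that(1)] D_norm_nonneg[OF M_pos that(1)]
        by (meson abs_ge_self mult_right_mono order_trans)
      also have "\<dots> \<le> \<bar>C\<bar>"
        using that(2) by (simp add: mult_left_le)
      finally show ?thesis .
    qed
    thus ?thesis by (intro bdd_aboveI[of _ "\<bar>C\<bar>"]) auto
  qed
  have p_le: "p J f \<le> \<kappa> J * D_norm M f" if f: "f \<in> D_space M" for J f
  proof (cases "D_norm M f = 0")
    case True
    thus ?thesis using continuous[of J] f by auto
  next
    case False
    hence pos: "D_norm M f > 0" using D_norm_nonneg[OF M_pos f] by simp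
    define c :: complex where "c = of_real (inverse (D_norm M f))"
    have norm_c: "norm c = inverse (D_norm M f)"
      using pos by (simp add: c_def norm_inverse)
    have "p J (\<lambda>z. c * f z) \<le> \<kappa> J"
      unfolding \<kappa>_def
      by (rule cSUP_upper[OF _ bdd])
         (use f pos in \<open>simp add: D_space_scale[OF M_pos] D_norm_scale[OF M_pos] norm_c\<close>)
    thus ?thesis using pos by (simp add: p_scale[OF f] norm_c field_simps)
  qed
  have "\<exists>B. \<forall>J. \<kappa> J \<le> B"
  proof (rule ccontr)
    assume "\<not> ?thesis"
    hence "\<forall>n. \<exists>J. \<kappa> J > 4 ^ n" by (meson not_le)
    then obtain J where J: "\<And>n::nat. \<kappa> (J n) > 4 ^ n" by metis
    have "\<exists>y. y \<in> D_space M \<and> D_norm M y \<le> 1 \<and> p (J n) y > 2 / 3 * \<kappa> (J n)" for n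
    proof -
      have "0 < \<kappa> (J n)" using J[of n] by (rule less_trans[rotated]) simp
      hence "2 / 3 * \<kappa> (J n) < \<kappa> (J n)" by simp
      hence "2 / 3 * \<kappa> (J n) < (SUP f\<in>{f \<in> D_space M. D_norm M f \<le> 1}. p (J n) f)"
        by (simp only: \<kappa>_def)
      thus ?thesis unfolding less_cSUP_iff[OF ball_nonempty bdd] by blast
    qed
    then obtain y where y: "\<And>n. y n \<in> D_space M" "\<And>n. D_norm M (y n) \<le> 1"
        "\<And>n. p (J n) (y n) > 2 / 3 * \<kappa> (J n)"
      by metis
    define r :: "nat \<Rightarrow> real" where "r n = (1 / 3) ^ n" for n
    define u where "u n = (\<lambda>z. of_real (r n) * y n z)" for n
    have r_pos: "r n > 0" for n by (simp add: r_def)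
    have u: "u n \<in> D_space M" "D_norm M (u n) \<le> r n" "p (J n) (u n) \<ge> 2 / 3 * \<kappa> (J n) * r n" for n
      unfolding u_def using y[of n] r_pos[of n]
      by (simp_all add: D_space_scale[OF M_pos] D_norm_scale[OF M_pos] p_scale mult_left_le)
    define s where "s n x = (if p (J n) (\<lambda>z. x z + u n z) \<ge> p (J n) (u n) then 1 else - 1 :: complex)"
      for n x
    define x where "x = rec_nat (\<lambda>z. 0) (\<lambda>n x z. x z + s n x * u n z)"
    have x_0: "x 0 = (\<lambda>z. 0)" and x_Suc: "x (Suc n) = (\<lambda>z. x n z + s n (x n) * u n z)" for n
      by (simp_all add: x_def)
    define g where "g n = (\<lambda>z. s n (x n) * u n z)" for n
    have norm_s: "norm (s n x) = 1" for n x by (simp add: s_def)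
    have g: "g n \<in> D_space M" "D_norm M (g n) \<le> r n" for n
      unfolding g_def using u[of n]
      by (simp_all add: D_space_scale[OF M_pos] D_norm_scale[OF M_pos] norm_s)
    have x_eq: "x n = (\<lambda>z. \<Sum>k<n. g k z)" for n
      by (induction n) (simp_all add: x_0 x_Suc g_def)
    have x: "x n \<in> D_space M" for n
      unfolding x_eq by (rule D_space_sum[OF M_pos g(1)])
    have no_cancellation: "p (J n) (x (Suc n)) \<ge> p (J n) (u n)" for n
    proof (cases "p (J n) (\<lambda>z. x n z + u n z) \<ge> p (J n) (u n)")
      case True
      thus ?thesis by (simp add: x_Suc s_def)
    next
      case False
      have minus: "(\<lambda>z. (- 1) * (x n z - u n z)) = (\<lambda>z. (- x n z) + u n z)"
        by (simp add: algebra_simps)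
      have diff: "(\<lambda>z. x n z - u n z) = (\<lambda>z. x n z + (- 1) * u n z)" by simp
      have d: "(\<lambda>z. x n z - u n z) \<in> D_space M"
        unfolding diff by (intro D_space_add[OF M_pos] D_space_scale[OF M_pos] x u)
      have sm: "(\<lambda>z. x n z + u n z) \<in> D_space M"
        by (intro D_space_add[OF M_pos] x u)
      have "2 * p (J n) (u n) = p (J n) (\<lambda>z. 2 * u n z)"
        by (simp add: p_scale[OF u(1)])
      also have "(\<lambda>z. 2 * u n z) = (\<lambda>z. (x n z + u n z) + (- 1) * (x n z - u n z))"
        by (simp add: algebra_simps)
      also have "p (J n) \<dots> \<le> p (J n) (\<lambda>z. x n z + u n z) + p (J n) (\<lambda>z. (- 1) * (x n z - u n z))"
        by (intro p_add sm D_space_scale[OF M_pos] d)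
      also have "p (J n) (\<lambda>z. (- 1) * (x n z - u n z)) = p (J n) (\<lambda>z. x n z - u n z)"
        by (subst p_scale[OF d]) simp
      finally show ?thesis using False by (simp add: x_Suc s_def)
    qed
    have summable_r: "summable r" unfolding r_def by (rule summable_geometric) simp
    have tail_r: "(\<Sum>k. r (k + Suc n)) = r n / 2" for n
    proof -
      have "(\<Sum>k. r (k + Suc n)) = (\<Sum>k. r (Suc n) * (1 / 3) ^ k)"
        by (simp add: r_def power_add mult_ac)
      also have "\<dots> = r (Suc n) * (1 / (1 - 1 / 3))"
        by (subst suminf_mult) (simp_all add: suminf_geometric summable_geometric)
      finally show ?thesis by (simp add: r_def)
    qed
    have summable_g: "summable (\<lambda>k. D_norm M (g k))"
      by (rule summable_comparison_test'[OF summable_r])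
         (use g D_norm_nonneg[OF M_pos g(1)] in auto)
    obtain f where f: "f \<in> D_space M"
      "\<And>m. (\<lambda>z. f z - (\<Sum>k<m. g k z)) \<in> D_space M"
      "\<And>m. D_norm M (\<lambda>z. f z - (\<Sum>k<m. g k z)) \<le> (\<Sum>k. D_norm M (g (k + m)))"
      using D_space_complete[OF M_pos g(1) summable_g] by blast
    \<comment> \<open>The terms after \<open>u n\<close> contribute at most \<open>\<kappa> (J n) * r n / 2\<close>, which is less than the
      \<open>2 / 3 * \<kappa> (J n) * r n\<close> secured by \<open>u n\<close>.\<close>
    have growth: "p (J n) f \<ge> (4 / 3) ^ n / 6" for n
    proof -
      let ?e = "\<lambda>z. f z - x (Suc n) z"
      have e: "?e \<in> D_space M" using f(2)[of "Suc n"] by (simp only: x_eq)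
      have "D_norm M ?e \<le> (\<Sum>k. D_norm M (g (k + Suc n)))"
        using f(3)[of "Suc n"] by (simp only: x_eq)
      also have "\<dots> \<le> (\<Sum>k. r (k + Suc n))"
        using g(2) by (intro suminf_le summable_ignore_initial_segment[OF summable_g]
            summable_ignore_initial_segment[OF summable_r])
      finally have e_le: "D_norm M ?e \<le> r n / 2" by (simp only: tail_r)
      have \<kappa>_pos: "0 < \<kappa> (J n)" using J[of n] by (rule less_trans[rotated]) simp
      have "p (J n) (x (Suc n)) = p (J n) (\<lambda>z. f z + (- 1) * ?e z)" by simp
      also have "\<dots> \<le> p (J n) f + p (J n) (\<lambda>z. (- 1) * ?e z)"
        by (intro p_add f(1) D_space_scale[OF M_pos] e)
      also have "p (J n) (\<lambda>z. (- 1) * ?e z) = p (J n) ?e"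
        by (subst p_scale[OF e]) simp
      also have "\<dots> \<le> \<kappa> (J n) * (r n / 2)"
        using p_le[OF e, of "J n"] e_le \<kappa>_pos by (meson less_imp_le mult_left_mono order_trans)
      finally have "\<kappa> (J n) * r n / 6 \<le> p (J n) f"
        using no_cancellation[of n] u(3)[of n] by (simp add: field_simps)
      moreover have "(4 / 3) ^ n \<le> \<kappa> (J n) * r n"
        using mult_right_mono[OF less_imp_le[OF J[of n]] less_imp_le[OF r_pos[of n]]]
        by (simp add: r_def power_divide)
      ultimately show ?thesis by simp
    qed
    obtain B where B: "\<And>J. p J f \<le> B" using pointwise[OF f(1)] by blast
    obtain n where "6 * B < (4 / 3) ^ n" using real_arch_pow[of "4 / 3" "6 * B"] by auto
    with growth[of n] B[of "J n"] show False by linarith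
  qed
  then obtain B where B: "\<And>J. \<kappa> J \<le> B" by blast
  have "p J f \<le> max B 1 * D_norm M f" if "f \<in> D_space M" for J f
    using p_le[OF that, of J] B[of J] D_norm_nonneg[OF M_pos that]
    by (meson max.coboundedI1 mult_right_mono order_trans)
  thus ?thesis by (intro exI[of _ "max B 1"]) auto
qed

text \<open>The coefficients of the higher order chain rule: the \<open>n\<close>-th derivative of \<open>f \<circ> g\<close> at \<open>z\<close> is
  the sum over \<open>i \<le> n\<close> of the \<open>i\<close>-th derivative of \<open>f\<close> at \<open>g z\<close> times \<open>chain_coeff g n i z\<close>.
  The recursion results from differentiating this identity.\<close>

primrec chain_coeff :: "(complex \<Rightarrow> complex) \<Rightarrow> nat \<Rightarrow> nat \<Rightarrow> complex \<Rightarrow> complex" where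
  "chain_coeff g 0 = (\<lambda>i z. if i = 0 then 1 else 0)"
| "chain_coeff g (Suc n) = (\<lambda>i z. deriv (chain_coeff g n i) z +
     (if i = 0 then 0 else chain_coeff g n (i - 1) z * deriv g z))"

lemma chain_coeff_eq_0: "n < i \<Longrightarrow> chain_coeff g n i = (\<lambda>z. 0)"
proof (induction n arbitrary: i)
  case (Suc n)
  thus ?case using Suc.IH[of i] Suc.IH[of "i - 1"] by simp
qed auto

lemma chain_coeff_diagonal: "chain_coeff g n n z = deriv g z ^ n"
  by (induction n) (simp_all add: chain_coeff_eq_0)

lemma chain_coeff_holomorphic:
  assumes "open U" "g holomorphic_on U"
  shows "chain_coeff g n i holomorphic_on U"
proof (induction n arbitrary: i)
  case (Suc n)
  show ?case
    by (cases "i = 0") (auto intro!: holomorphic_intros holomorphic_deriv Suc assms)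
qed auto

text \<open>A self-map \<open>\<psi>\<close> of the closed disc together with a holomorphic extension \<open>g\<close> to a
  neighbourhood \<open>U\<close>.  The coefficients \<open>chain_coeff g n i\<close> are then holomorphic on \<open>U\<close>, in
  particular bounded on the disc, whereas \<open>\<psi>\<close> may take arbitrary values outside of it.\<close>

locale analytic_disc_map =
  fixes U :: "complex set" and g \<psi> :: "complex \<Rightarrow> complex"
  assumes open_U: "open U" and cdisc_subset: "cdisc \<subseteq> U"
    and holomorphic: "g holomorphic_on U"
    and g_eq: "\<And>z. z \<in> cdisc \<Longrightarrow> g z = \<psi> z"
    and maps_to: "\<And>z. z \<in> cdisc \<Longrightarrow> \<psi> z \<in> cdisc"
begin

lemma has_field_derivative_within:
  assumes "z \<in> cdisc"
  shows "(\<psi> has_field_derivative deriv g z) (at z within cdisc)"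
proof (rule has_field_derivative_transform_within[OF _ zero_less_one assms g_eq])
  show "(g has_field_derivative deriv g z) (at z within cdisc)"
    using holomorphic_derivI[OF holomorphic open_U] assms cdisc_subset
    by (blast intro: has_field_derivative_at_within)
qed

lemma
  assumes f: "f \<in> D_infinity"
  shows D_infinity_comp: "f \<circ> \<psi> \<in> D_infinity"
    and cdisc_higher_deriv_comp: "z \<in> cdisc \<Longrightarrow> cdisc_higher_deriv n (f \<circ> \<psi>) z
      = (\<Sum>i\<le>n. cdisc_higher_deriv i f (\<psi> z) * chain_coeff g n i z)"
proof -
  let ?F = "\<lambda>n z. \<Sum>i\<le>n. cdisc_higher_deriv i f (\<psi> z) * chain_coeff g n i z"
  have F: "(?F n has_field_derivative ?F (Suc n) z) (at z within cdisc)" if z: "z \<in> cdisc" for n z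
  proof -
    let ?f = "\<lambda>i. cdisc_higher_deriv i f"
    have inner: "((\<lambda>z. ?f i (\<psi> z)) has_field_derivative ?f (Suc i) (\<psi> z) * deriv g z)
        (at z within cdisc)" for i
    proof -
      have "(?f i has_field_derivative ?f (Suc i) (\<psi> z)) (at (\<psi> z) within \<psi> ` cdisc)"
        using maps_to
        by (intro has_field_derivative_subset[OF D_infinity_has_field_derivative[OF f maps_to[OF z]]]) blast
      from DERIV_image_chain[OF this has_field_derivative_within[OF z]] show ?thesis
        by (simp add: o_def)
    qed
    have coeff: "(chain_coeff g n i has_field_derivative deriv (chain_coeff g n i) z) (at z within cdisc)" for i
      using holomorphic_derivI[OF chain_coeff_holomorphic[OF open_U holomorphic] open_U] z cdisc_subset
      by (blast intro: has_field_derivative_at_within)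
    have "(?F n has_field_derivative (\<Sum>i\<le>n. ?f (Suc i) (\<psi> z) * deriv g z * chain_coeff g n i z
        + deriv (chain_coeff g n i) z * ?f i (\<psi> z))) (at z within cdisc)"
      by (intro DERIV_sum DERIV_mult inner coeff)
    also have "(\<Sum>i\<le>n. ?f (Suc i) (\<psi> z) * deriv g z * chain_coeff g n i z
        + deriv (chain_coeff g n i) z * ?f i (\<psi> z))
      = (\<Sum>i\<le>n. ?f (Suc i) (\<psi> z) * (chain_coeff g n i z * deriv g z))
        + (\<Sum>i\<le>Suc n. ?f i (\<psi> z) * deriv (chain_coeff g n i) z)"
      by (simp add: sum.distrib chain_coeff_eq_0 mult_ac del: funpow.simps)
    also have "(\<Sum>i\<le>n. ?f (Suc i) (\<psi> z) * (chain_coeff g n i z * deriv g z))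
      = (\<Sum>i\<le>Suc n. ?f i (\<psi> z) * (if i = 0 then 0 else chain_coeff g n (i - 1) z * deriv g z))"
      by (subst sum.atMost_Suc_shift) (simp del: funpow.simps)
    finally show ?thesis
      by (simp add: sum.distrib distrib_left add_ac del: funpow.simps sum.atMost_Suc)
  qed
  show "f \<circ> \<psi> \<in> D_infinity"
    by (rule D_infinityI[of ?F]) (use F in auto)
  show "z \<in> cdisc \<Longrightarrow> cdisc_higher_deriv n (f \<circ> \<psi>) z = ?F n z"
    by (rule cdisc_higher_deriv_eqI[of ?F]) (use F in auto)
qed

lemma higher_sup_norm_comp_le:
  assumes f: "f \<in> D_infinity"
  shows "higher_sup_norm n (f \<circ> \<psi>) \<le> (\<Sum>i\<le>n. higher_sup_norm i f * cdisc_sup_norm (chain_coeff g n i))"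
proof (rule cdisc_sup_norm_le)
  fix z :: complex assume z: "z \<in> cdisc"
  have cont: "continuous_on cdisc (chain_coeff g n i)" for i
    using chain_coeff_holomorphic[OF open_U holomorphic] cdisc_subset
    by (meson holomorphic_on_imp_continuous_on continuous_on_subset)
  show "norm (cdisc_higher_deriv n (f \<circ> \<psi>) z)
      \<le> (\<Sum>i\<le>n. higher_sup_norm i f * cdisc_sup_norm (chain_coeff g n i))"
    unfolding cdisc_higher_deriv_comp[OF f z]
    using norm_le_higher_sup_norm[OF f maps_to[OF z]] norm_le_cdisc_sup_norm[OF cont z]
      higher_sup_norm_nonneg[OF f]
    by (intro sum_norm_le) (auto simp: norm_mult intro: mult_mono)
qed

text \<open>An instance of the closed graph theorem: the partial sums of the norm of \<open>f \<circ> \<psi>\<close> are continuous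
  seminorms of \<open>f\<close> by the chain rule, so they are uniformly bounded.\<close>

lemma endomorphism_bounded:
  assumes M_pos: "\<And>n. M n > 0" and endo: "induces_endomorphism M \<psi>"
  shows "\<exists>K>0. \<forall>f\<in>D_space M. D_norm M (f \<circ> \<psi>) \<le> K * D_norm M f"
proof -
  define p where "p J f = (\<Sum>n<J. higher_sup_norm n (f \<circ> \<psi>) / M n)" for J f
  have "\<exists>K>0. \<forall>f\<in>D_space M. \<forall>J. p J f \<le> K * D_norm M f"
  proof (rule D_space_uniform_boundedness[OF M_pos])
    fix J f h assume fh: "f \<in> D_space M" "h \<in> D_space M"
    have eq: "(\<lambda>z. f z + h z) \<circ> \<psi> = (\<lambda>z. (f \<circ> \<psi>) z + (h \<circ> \<psi>) z)" by (simp add: o_def)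
    have "higher_sup_norm n ((\<lambda>z. f z + h z) \<circ> \<psi>) / M n
        \<le> higher_sup_norm n (f \<circ> \<psi>) / M n + higher_sup_norm n (h \<circ> \<psi>) / M n" for n
      unfolding eq add_divide_distrib[symmetric]
      using M_pos[of n] fh
      by (intro divide_right_mono higher_sup_norm_add D_infinity_comp D_space_imp_D_infinity) auto
    thus "p J (\<lambda>z. f z + h z) \<le> p J f + p J h"
      unfolding p_def sum.distrib[symmetric] by (rule sum_mono)
  next
    fix J f and c :: complex assume f: "f \<in> D_space M"
    have eq: "(\<lambda>z. c * f z) \<circ> \<psi> = (\<lambda>z. c * (f \<circ> \<psi>) z)" by (simp add: o_def)
    show "p J (\<lambda>z. c * f z) = norm c * p J f"
      unfolding p_def eq higher_sup_norm_scale[OF D_infinity_comp[OF D_space_imp_D_infinity[OF f]]]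
      by (simp add: sum_distrib_left)
  next
    fix J
    define C where "C = (\<Sum>n<J. (\<Sum>i\<le>n. M i * cdisc_sup_norm (chain_coeff g n i)) / M n)"
    have "p J f \<le> C * D_norm M f" if f: "f \<in> D_space M" for f
    proof -
      have cont: "continuous_on cdisc (chain_coeff g n i)" for n i
        using chain_coeff_holomorphic[OF open_U holomorphic] cdisc_subset
        by (meson holomorphic_on_imp_continuous_on continuous_on_subset)
      have "higher_sup_norm n (f \<circ> \<psi>)
          \<le> (\<Sum>i\<le>n. M i * cdisc_sup_norm (chain_coeff g n i)) * D_norm M f" for n
      proof -
        have "higher_sup_norm n (f \<circ> \<psi>)
            \<le> (\<Sum>i\<le>n. higher_sup_norm i f * cdisc_sup_norm (chain_coeff g n i))"
          by (rule higher_sup_norm_comp_le[OF D_space_imp_D_infinity[OF f]])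
        also have "\<dots> \<le> (\<Sum>i\<le>n. (M i * D_norm M f) * cdisc_sup_norm (chain_coeff g n i))"
          by (intro sum_mono mult_right_mono higher_sup_norm_le_D_norm[OF M_pos f]
              cdisc_sup_norm_nonneg cont)
        also have "\<dots> = (\<Sum>i\<le>n. M i * cdisc_sup_norm (chain_coeff g n i)) * D_norm M f"
          unfolding sum_distrib_right by (intro sum.cong) (simp_all add: mult_ac)
        finally show ?thesis .
      qed
      hence "p J f \<le> (\<Sum>n<J. (\<Sum>i\<le>n. M i * cdisc_sup_norm (chain_coeff g n i)) * D_norm M f / M n)"
        unfolding p_def using M_pos by (intro sum_mono divide_right_mono) (auto intro: less_imp_le)
      thus ?thesis by (simp add: C_def sum_distrib_right)
    qed
    thus "\<exists>C. \<forall>f\<in>D_space M. p J f \<le> C * D_norm M f" by blast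
  next
    fix f assume "f \<in> D_space M"
    hence "f \<circ> \<psi> \<in> D_space M" using endo by (simp add: induces_endomorphism_def)
    thus "\<exists>B. \<forall>J. p J f \<le> B" unfolding p_def using sum_le_D_norm[of M, OF M_pos] by blast
  qed
  then obtain K where "K > 0" and K: "\<And>f J. f \<in> D_space M \<Longrightarrow> p J f \<le> K * D_norm M f" by blast
  moreover have "D_norm M (f \<circ> \<psi>) \<le> K * D_norm M f" if "f \<in> D_space M" for f
    using K[OF that] D_infinity_comp[OF D_space_imp_D_infinity[OF that]]
    unfolding p_def by (intro D_norm_le[OF M_pos]) auto
  ultimately show ?thesis by blast
qed

lemma cdisc_higher_deriv_comp_at_fixed_point:
  assumes "f \<in> D_infinity" "a \<in> cdisc" "\<psi> a = a"
    and "\<And>i. i < n \<Longrightarrow> cdisc_higher_deriv i f a = 0" and "m \<le> n"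
  shows "cdisc_higher_deriv m (f \<circ> \<psi>) a = cdisc_higher_deriv m f a * deriv g a ^ m"
proof -
  have "cdisc_higher_deriv m (f \<circ> \<psi>) a
      = (\<Sum>i\<le>m. if i = m then cdisc_higher_deriv m f a * deriv g a ^ m else 0)"
    unfolding cdisc_higher_deriv_comp[OF assms(1,2)] assms(3)
    using assms(4,5) by (intro sum.cong) (auto simp: chain_coeff_diagonal)
  thus ?thesis by simp
qed

end

lemma
  fixes a :: complex
  assumes M_pos: "\<And>n. M n > 0"
  shows D_space_power: "(\<lambda>z. (z - a) ^ n) \<in> D_space M"
    and cdisc_higher_deriv_power: "a \<in> cdisc \<Longrightarrow>
      cdisc_higher_deriv m (\<lambda>z. (z - a) ^ n) a = (if m = n then fact n else 0)"
proof -
  define F :: "nat \<Rightarrow> complex \<Rightarrow> complex"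
    where "F m z = of_nat (fact m * (n choose m)) * (z - a) ^ (n - m)" for m z
  have "Suc m * (n choose Suc m) = (n - m) * (n choose m)" for m
    by (metis binomial_absorb_comp binomial_absorption mult.commute)
  hence choose: "fact m * (n choose m) * (n - m) = fact (Suc m) * (n choose Suc m)" for m
    by (metis fact_Suc mult.assoc mult.commute of_nat_id)
  have F: "(F m has_field_derivative F (Suc m) z) (at z within cdisc)" for m z
  proof -
    have "(F m has_field_derivative of_nat (fact m * (n choose m)) *
        (of_nat (n - m) * (z - a) ^ (n - m - 1))) (at z within cdisc)"
      unfolding F_def by (auto intro!: derivative_eq_intros)
    also have "of_nat (fact m * (n choose m)) * (of_nat (n - m) * (z - a) ^ (n - m - 1)) = F (Suc m) z"
      unfolding F_def choose[symmetric] of_nat_mult by (simp add: mult_ac)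
    finally show ?thesis .
  qed
  have F0: "F 0 z = (z - a) ^ n" for z by (simp add: F_def)
  have D: "(\<lambda>z. (z - a) ^ n) \<in> D_infinity"
    by (rule D_infinityI[of F]) (use F F0 in auto)
  have deriv: "cdisc_higher_deriv m (\<lambda>z. (z - a) ^ n) z = F m z" if "z \<in> cdisc" for m z
    by (rule cdisc_higher_deriv_eqI[of F]) (use F F0 that in auto)
  have "higher_sup_norm m (\<lambda>z. (z - a) ^ n) = 0" if "m \<notin> {..n}" for m
  proof -
    have "higher_sup_norm m (\<lambda>z. (z - a) ^ n) = cdisc_sup_norm (\<lambda>z. 0)"
      using that by (intro cdisc_sup_norm_cong) (simp add: deriv F_def)
    thus ?thesis by (simp add: cdisc_sup_norm_def)
  qed
  hence "summable (\<lambda>m. higher_sup_norm m (\<lambda>z. (z - a) ^ n) / M m)"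
    by (intro summable_finite[of "{..n}"]) auto
  with D show "(\<lambda>z. (z - a) ^ n) \<in> D_space M" by (simp add: D_space_def)
  show "cdisc_higher_deriv m (\<lambda>z. (z - a) ^ n) a = (if m = n then fact n else 0)" if "a \<in> cdisc"
    unfolding deriv[OF that] by (auto simp: F_def not_less binomial_eq_0)
qed

text \<open>Repeated composition of \<open>(z - a) ^ n\<close> with \<open>\<psi>\<close> multiplies the \<open>n\<close>-th derivative at
  the fixed point \<open>a\<close> by the \<open>n\<close>-th power of the multiplier each time.  The norm of the composition
  operator would therefore be at least this power, for every \<open>n\<close>.\<close>

lemma (in analytic_disc_map) repelling_fixed_point_not_endomorphism:
  assumes M_pos: "\<And>n. M n > 0"
    and a: "a \<in> cdisc" "\<psi> a = a" and repelling: "norm (deriv g a) > 1"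
  shows "\<not> induces_endomorphism M \<psi>"
proof
  assume endo: "induces_endomorphism M \<psi>"
  obtain K where "K > 0" and K: "\<And>f. f \<in> D_space M \<Longrightarrow> D_norm M (f \<circ> \<psi>) \<le> K * D_norm M f"
    using endomorphism_bounded[OF M_pos endo] by blast
  obtain n where n: "K < norm (deriv g a) ^ n"
    using real_arch_pow[OF repelling] by blast
  define f where "f k = (\<lambda>z. (z - a) ^ n) \<circ> (\<psi> ^^ k)" for k
  have f_Suc: "f (Suc k) = f k \<circ> \<psi>" for k
    by (simp add: f_def comp_assoc funpow_Suc_right del: funpow.simps)
  have f: "f k \<in> D_space M" for k
  proof (induction k)
    case 0
    show ?case using D_space_power[OF M_pos] by (simp add: f_def)
  next
    case (Suc k)
    thus ?case using endo unfolding f_Suc induces_endomorphism_def by blast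
  qed
  have norm_le: "D_norm M (f k) \<le> K ^ k * D_norm M (f 0)" for k
  proof (induction k)
    case (Suc k)
    have "D_norm M (f (Suc k)) \<le> K * D_norm M (f k)"
      unfolding f_Suc by (rule K[OF f])
    also have "\<dots> \<le> K * (K ^ k * D_norm M (f 0))"
      using Suc \<open>K > 0\<close> by (intro mult_left_mono) auto
    finally show ?case by simp
  qed simp
  have deriv_f: "cdisc_higher_deriv m (f k) a = (if m = n then fact n * (deriv g a ^ n) ^ k else 0)"
    if "m \<le> n" for m k
    using that
  proof (induction k arbitrary: m)
    case 0
    show ?case using cdisc_higher_deriv_power[OF M_pos a(1)] by (simp add: f_def)
  next
    case (Suc k)
    have "cdisc_higher_deriv m (f (Suc k)) a = cdisc_higher_deriv m (f k) a * deriv g a ^ m"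
      unfolding f_Suc
      by (rule cdisc_higher_deriv_comp_at_fixed_point[where n = n])
         (use a f D_space_imp_D_infinity Suc in auto)
    thus ?case using Suc by simp
  qed
  have "fact n * (norm (deriv g a) ^ n) ^ k \<le> M n * (K ^ k * D_norm M (f 0))" for k
  proof -
    have "fact n * (norm (deriv g a) ^ n) ^ k = norm (cdisc_higher_deriv n (f k) a)"
      by (simp add: deriv_f norm_mult norm_power)
    also have "\<dots> \<le> higher_sup_norm n (f k)"
      by (intro norm_le_higher_sup_norm D_space_imp_D_infinity[OF f] a)
    also have "\<dots> \<le> M n * D_norm M (f k)"
      by (rule higher_sup_norm_le_D_norm[OF M_pos f])
    also have "\<dots> \<le> M n * (K ^ k * D_norm M (f 0))"
      using norm_le M_pos[of n] by (intro mult_left_mono) auto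
    finally show ?thesis .
  qed
  hence bounded: "(norm (deriv g a) ^ n / K) ^ k \<le> M n * D_norm M (f 0) / fact n" for k
    using \<open>K > 0\<close> by (simp add: power_divide field_simps)
  have "1 < norm (deriv g a) ^ n / K" using n \<open>K > 0\<close> by simp
  then obtain k where "M n * D_norm M (f 0) / fact n < (norm (deriv g a) ^ n / K) ^ k"
    using real_arch_pow by blast
  with bounded[of k] show False by simp
qed


section \<open>Boundary fixed points of self-maps of the disc\<close>

lemma Moebius_function_denominator:
  fixes a z :: complex
  assumes "norm a < 1" "norm z \<le> 1"
  shows "1 - cnj a * z \<noteq> 0"
proof
  assume "1 - cnj a * z = 0"
  hence "norm (cnj a * z) = 1" by simp
  moreover have "norm a * norm z \<le> norm a * 1" using assms(2) by (intro mult_left_mono) auto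
  ultimately show False using assms(1) by (simp add: norm_mult)
qed

lemma Moebius_function_norm_identity:
  assumes "norm a < 1" "norm z \<le> 1"
  shows "1 - norm (Moebius_function 0 a z) ^ 2
    = (1 - norm a ^ 2) / norm (1 - cnj a * z) ^ 2 * (1 - norm z ^ 2)"
proof -
  have "norm (1 - cnj a * z) ^ 2 - norm (z - a) ^ 2 = (1 - norm a ^ 2) * (1 - norm z ^ 2)"
    unfolding cmod_power2 by (simp add: algebra_simps power2_eq_square)
  thus ?thesis
    using Moebius_function_denominator[OF assms]
    by (simp add: Moebius_function_simple norm_divide power_divide field_simps)
qed

lemma Moebius_function_continuous_on:
  assumes "norm a < 1"
  shows "continuous_on cdisc (Moebius_function 0 a)"
  unfolding Moebius_function_simple[abs_def]
  using Moebius_function_denominator[OF assms] by (intro continuous_intros) auto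

lemma Schwarz_Pick_origin:
  assumes h: "h holomorphic_on udisc" "\<And>z. norm z < 1 \<Longrightarrow> norm (h z) < 1" and z: "norm z < 1"
  shows "norm (h z) \<le> (norm (h 0) + norm z) / (1 + norm (h 0) * norm z)"
proof -
  define a where "a = h 0"
  have a: "norm a < 1" using h(2)[of 0] by (simp add: a_def)
  define k where "k = Moebius_function 0 a \<circ> h"
  have "k holomorphic_on udisc"
    unfolding k_def using h
    by (intro holomorphic_on_compose_gen[OF h(1) Moebius_function_holomorphic[OF a]]) auto
  moreover have "k 0 = 0" by (simp add: k_def a_def Moebius_function_eq_zero)
  moreover have "norm (k z) < 1" if "norm z < 1" for z
    using Moebius_function_norm_lt_1[OF a h(2)[OF that]] by (simp add: k_def)
  ultimately have "norm (k z) \<le> norm z" using z by (rule Schwarz_Lemma(1))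
  hence "norm (h z - a) \<le> norm z * norm (1 - cnj a * h z)"
    using Moebius_function_denominator[OF a less_imp_le[OF h(2)[OF z]]]
    by (simp add: k_def Moebius_function_simple norm_divide field_simps)
  hence le: "norm (h z - a) ^ 2 \<le> norm z ^ 2 * norm (1 - cnj a * h z) ^ 2"
    by (metis norm_ge_zero power_mono power_mult_distrib)
  define x y r where "x = norm a" and "y = norm (h z)" and "r = norm z"
  have range: "0 \<le> x" "x < 1" "0 \<le> y" "y < 1" "0 \<le> r" "r < 1"
    using a h(2)[OF z] z by (auto simp: x_def y_def r_def)
  have eq: "norm (1 - cnj a * h z) ^ 2 - norm (h z - a) ^ 2 = (1 - x ^ 2) * (1 - y ^ 2)"
    unfolding cmod_power2 x_def y_def by (simp add: algebra_simps power2_eq_square)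
  have "1 - x * y \<le> norm (1 - cnj a * h z)"
    using norm_triangle_ineq2[of 1 "cnj a * h z"] by (simp add: norm_mult x_def y_def)
  moreover have xy: "x * y < 1" using range mult_left_le[of y x] by linarith
  ultimately have "(1 - x * y) ^ 2 \<le> norm (1 - cnj a * h z) ^ 2"
    by (intro power_mono) auto
  hence "(1 - r ^ 2) * (1 - x * y) ^ 2 \<le> (1 - r ^ 2) * norm (1 - cnj a * h z) ^ 2"
    using range by (intro mult_left_mono) (auto simp: power_le_one)
  also have "\<dots> \<le> (1 - x ^ 2) * (1 - y ^ 2)"
    using le unfolding eq[symmetric] r_def by (simp add: algebra_simps)
  finally have "(y - x) ^ 2 \<le> (r * (1 - x * y)) ^ 2"
    by (simp add: algebra_simps power2_eq_square)
  hence "y - x \<le> r * (1 - x * y)"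
    by (rule power2_le_imp_le) (use range xy in simp)
  hence "y * (1 + x * r) \<le> x + r" by (simp add: algebra_simps)
  moreover have "1 + x * r > 0" using range by (simp add: add_pos_nonneg)
  ultimately show ?thesis
    unfolding x_def y_def r_def a_def by (simp add: pos_le_divide_eq)
qed

text \<open>If a self-map of the disc other than an automorphism has an interior fixed point, then
  its boundary fixed points are repelling.  In a coordinate in which the interior fixed point is
  \<open>0\<close>, the map has the form \<open>w \<mapsto> w * h w\<close> with \<open>h\<close> a self-map of the open disc, and
  the bound on \<open>h\<close> given by the Schwarz--Pick lemma forces radial expansion by
  at least \<open>2 / (1 + norm (h 0))\<close> at the boundary.\<close>

lemma boundary_fixed_point_repelling:
  assumes cont: "continuous_on cdisc \<psi>" and hol: "\<psi> holomorphic_on udisc"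
    and maps: "\<And>z. norm z < 1 \<Longrightarrow> norm (\<psi> z) < 1" "\<And>z. norm z \<le> 1 \<Longrightarrow> norm (\<psi> z) \<le> 1"
    and b: "norm b < 1" "\<psi> b = b" and a: "norm a = 1" "\<psi> a = a"
    and \<zeta>: "norm \<zeta> = 1" "norm (\<psi> \<zeta>) < 1"
    and deriv: "(\<psi> has_field_derivative l) (at a within cdisc)"
  shows "norm l > 1"
proof -
  define m where "m = Moebius_function 0 b"
  define m' where "m' = Moebius_function 0 (- b)"
  define c where "c w = (1 - norm b ^ 2) / norm (1 - cnj b * w) ^ 2" for w
  have m_lt_1: "norm (m z) < 1" "norm (m' z) < 1" if "norm z < 1" for z
    unfolding m_def m'_def using Moebius_function_norm_lt_1 b that by auto
  have m_identity: "1 - norm (m w) ^ 2 = c w * (1 - norm w ^ 2)" if "norm w \<le> 1" for w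
    unfolding m_def c_def by (rule Moebius_function_norm_identity[OF b(1) that])
  have m_cont: "continuous_on cdisc m"
    unfolding m_def by (rule Moebius_function_continuous_on[OF b(1)])
  have m'_m: "m' (m z) = z" if "norm z < 1" for z
    unfolding m_def m'_def using b that by (intro Moebius_function_compose) auto
  define G where "G = m \<circ> (\<psi> \<circ> m')"
  have "\<psi> \<circ> m' holomorphic_on udisc"
    using b m_lt_1(2) unfolding m'_def
    by (intro holomorphic_on_compose_gen[OF Moebius_function_holomorphic hol]) auto
  hence G_hol: "G holomorphic_on udisc"
    unfolding G_def m_def
  proof (rule holomorphic_on_compose_gen[OF _ Moebius_function_holomorphic[OF b(1)]])
    show "(\<psi> \<circ> m') ` udisc \<subseteq> udisc" using maps(1)[OF m_lt_1(2)] by auto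
  qed
  have G_0: "G 0 = 0"
    by (simp add: G_def m_def m'_def Moebius_function_of_zero b Moebius_function_eq_zero)
  have G_lt_1: "norm (G z) < 1" if "norm z < 1" for z
    using m_lt_1 maps that by (simp add: G_def)
  have G_m: "G (m z) = m (\<psi> z)" if "norm z < 1" for z
    using m'_m[OF that] by (simp add: G_def)
  \<comment> \<open>A rotation would preserve the norm of \<open>m\<close>, so \<open>\<psi>\<close> would map the circle into itself.\<close>
  have no_rotation: "\<not> (\<exists>\<alpha>. (\<forall>z. norm z < 1 \<longrightarrow> G z = \<alpha> * z) \<and> norm \<alpha> = 1)"
  proof
    assume "\<exists>\<alpha>. (\<forall>z. norm z < 1 \<longrightarrow> G z = \<alpha> * z) \<and> norm \<alpha> = 1"
    then obtain \<alpha> where \<alpha>: "\<And>z. norm z < 1 \<Longrightarrow> G z = \<alpha> * z" "norm \<alpha> = 1" by blast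
    have agree: "norm (m (\<psi> z)) - norm (m z) = 0" if "norm z < 1" for z
      unfolding G_m[OF that, symmetric] \<alpha>(1)[OF m_lt_1(1)[OF that]] norm_mult \<alpha>(2) by simp
    have "continuous_on cdisc (\<lambda>z. norm (m (\<psi> z)) - norm (m z))"
      using maps(2)
      by (intro continuous_on_diff continuous_on_norm continuous_on_compose2[OF m_cont cont] m_cont) auto
    hence closure_cont: "continuous_on (closure udisc) (\<lambda>z. norm (m (\<psi> z)) - norm (m z))"
      by simp
    have "norm (m (\<psi> \<zeta>)) - norm (m \<zeta>) = 0"
    proof (rule continuous_constant_on_closure[OF closure_cont])
      show "norm (m (\<psi> z)) - norm (m z) = 0" if "z \<in> udisc" for z
        using that by (intro agree) simp
    qed (use \<zeta>(1) in simp)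
    moreover have "norm (m \<zeta>) ^ 2 = 1" using m_identity[of \<zeta>] \<zeta>(1) by simp
    ultimately have "norm (m (\<psi> \<zeta>)) ^ 2 = 1" by simp
    moreover have "norm (m (\<psi> \<zeta>)) ^ 2 < 1"
      using m_lt_1(1)[OF \<zeta>(2)] by (simp add: power_less_one_iff)
    ultimately show False by simp
  qed
  obtain h where h: "h holomorphic_on udisc" "\<And>z. norm z < 1 \<Longrightarrow> G z = z * h z" "deriv G 0 = h 0"
    using Schwarz3[OF G_hol G_0] by blast
  note Schwarz = Schwarz_Lemma[OF G_hol G_0 G_lt_1]
  have h_lt_1: "norm (h z) < 1" if z: "norm z < 1" for z
  proof (cases "z = 0")
    case True
    have "norm (deriv G 0) \<noteq> 1" using Schwarz(3)[of 0] no_rotation by auto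
    thus ?thesis using Schwarz(2)[of 0] h(3) True by simp
  next
    case False
    have "norm (G z) \<noteq> norm z" using Schwarz(3)[of 0] no_rotation False z by auto
    hence "norm (G z) < norm z" using Schwarz(1)[OF _ z] by simp
    thus ?thesis using False by (simp add: h(2)[OF z] norm_mult)
  qed
  define \<alpha> where "\<alpha> = norm (h 0)"
  have \<alpha>: "0 \<le> \<alpha>" "\<alpha> < 1" using h_lt_1[of 0] by (auto simp: \<alpha>_def)
  \<comment> \<open>Schwarz--Pick in terms of \<open>1 - norm z ^ 2\<close>: the factors \<open>c\<close> come from the coordinate
    change and cancel in the limit, as \<open>\<psi>\<close> fixes \<open>a\<close>.\<close>
  have interior: "c z * (1 - norm z ^ 2) * (1 + norm (m (\<psi> z))) \<le> c (\<psi> z) * (1 - norm (\<psi> z) ^ 2) * (1 + \<alpha>)"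
    if z: "norm z < 1" for z
  proof -
    define r \<rho> where "r = norm (m z)" and "\<rho> = norm (m (\<psi> z))"
    have r: "0 \<le> r" "r < 1" using m_lt_1[OF z] by (auto simp: r_def)
    have "\<rho> = r * norm (h (m z))"
      unfolding r_def \<rho>_def G_m[OF z, symmetric] h(2)[OF m_lt_1(1)[OF z]] by (rule norm_mult)
    also have "\<dots> \<le> r * ((\<alpha> + r) / (1 + \<alpha> * r))"
      unfolding \<alpha>_def r_def by (intro mult_left_mono Schwarz_Pick_origin h h_lt_1 m_lt_1 z) auto
    finally have "\<rho> \<le> r * (\<alpha> + r) / (1 + \<alpha> * r)" by simp
    moreover have "0 < 1 + \<alpha> * r" using r \<alpha> by (simp add: add_pos_nonneg)
    ultimately have "\<rho> * (1 + \<alpha> * r) \<le> r * (\<alpha> + r)" by (simp only: pos_le_divide_eq)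
    hence "1 - r ^ 2 \<le> (1 - \<rho>) * (1 + \<alpha> * r)"
      by (simp add: algebra_simps power2_eq_square)
    also have "\<dots> \<le> (1 - \<rho>) * (1 + \<alpha>)"
      using r \<alpha> m_lt_1(1)[OF maps(1)[OF z]] by (intro mult_left_mono) (auto simp: \<rho>_def mult_left_le)
    finally have "(1 - r ^ 2) * (1 + \<rho>) \<le> (1 - \<rho>) * (1 + \<alpha>) * (1 + \<rho>)"
      by (intro mult_right_mono) (auto simp: \<rho>_def)
    also have "\<dots> = (1 - \<rho> ^ 2) * (1 + \<alpha>)" by (simp add: algebra_simps power2_eq_square)
    finally show ?thesis
      unfolding r_def \<rho>_def using m_identity[of z] m_identity[of "\<psi> z"] z maps(1)[OF z] by simp
  qed
  define \<gamma> where "\<gamma> t = of_real t * a" for t :: real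
  have norm_\<gamma>: "norm (\<gamma> t) = t" if "0 \<le> t" for t using that a by (simp add: \<gamma>_def norm_mult)
  have unit: "\<forall>\<^sub>F t in at_left 1. 0 < t \<and> t < (1::real)"
    by (intro eventually_conj eventually_at_leftI[of 0]) auto
  have norm_diff: "norm (\<gamma> t - a) = 1 - t" if "t < 1" for t
  proof -
    have "\<gamma> t - a = of_real (t - 1) * a" by (simp add: \<gamma>_def algebra_simps)
    thus ?thesis using that a by (simp only: norm_mult norm_of_real) simp
  qed
  have \<gamma>_tendsto: "(\<gamma> \<longlongrightarrow> a) (at_left 1)"
    unfolding \<gamma>_def by (auto intro!: tendsto_eq_intros)
  have \<gamma>_lim: "filterlim \<gamma> (at a within cdisc) (at_left 1)"
  proof (subst filterlim_at, intro conjI)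
    show "\<forall>\<^sub>F t in at_left 1. \<gamma> t \<in> cdisc \<and> \<gamma> t \<noteq> a"
      using unit
    proof eventually_elim
      case (elim t)
      thus ?case using norm_\<gamma>[of t] norm_diff[of t] by auto
    qed
  qed (rule \<gamma>_tendsto)
  have a_cdisc: "a \<in> cdisc" using a by simp
  have \<psi>_lim: "((\<lambda>t. \<psi> (\<gamma> t)) \<longlongrightarrow> a) (at_left 1)"
  proof (rule filterlim_compose[OF _ \<gamma>_lim])
    show "(\<psi> \<longlongrightarrow> a) (at a within cdisc)"
      using cont[unfolded continuous_on_def] a_cdisc a(2) by metis
  qed
  have m_lim: "((\<lambda>t. m (\<psi> (\<gamma> t))) \<longlongrightarrow> m a) (at_left 1)"
  proof (rule continuous_on_tendsto_compose[OF m_cont \<psi>_lim a_cdisc])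
    show "\<forall>\<^sub>F t in at_left 1. \<psi> (\<gamma> t) \<in> cdisc"
      using unit by eventually_elim (simp add: maps(2) norm_\<gamma>)
  qed
  have c_nz: "1 - cnj b * a \<noteq> 0"
    using a b by (intro Moebius_function_denominator) auto
  have c_lim: "((\<lambda>t. c (f t)) \<longlongrightarrow> c a) (at_left 1)" if "(f \<longlongrightarrow> a) (at_left 1)" for f :: "real \<Rightarrow> complex"
    unfolding c_def using c_nz by (intro tendsto_intros that) auto
  define q where "q t = norm ((\<psi> (\<gamma> t) - \<psi> a) / (\<gamma> t - a))" for t
  have q_lim: "(q \<longlongrightarrow> norm l) (at_left 1)"
    unfolding q_def
    using filterlim_compose[OF deriv[unfolded has_field_derivative_iff] \<gamma>_lim]
    by (rule tendsto_norm)
  have c_pos: "c w > 0" if "norm w \<le> 1" for w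
    unfolding c_def using Moebius_function_denominator[OF b(1) that] b(1)
    by (simp add: power_less_one_iff)
  have radial: "c (\<gamma> t) * (1 + t) * (1 + norm (m (\<psi> (\<gamma> t))))
      \<le> c (\<psi> (\<gamma> t)) * (1 + norm (\<psi> (\<gamma> t))) * q t * (1 + \<alpha>)" if t: "0 < t" "t < 1" for t
  proof -
    have "1 - norm (\<psi> (\<gamma> t)) \<le> norm (\<psi> a - \<psi> (\<gamma> t))"
      using norm_triangle_ineq2[of "\<psi> a" "\<psi> (\<gamma> t)"] a by simp
    also have "\<dots> = q t * (1 - t)"
      using norm_diff[OF t(2)] t by (simp add: q_def norm_divide norm_minus_commute)
    finally have q: "1 - norm (\<psi> (\<gamma> t)) \<le> q t * (1 - t)" .
    have \<gamma>t: "norm (\<gamma> t) < 1" using t norm_\<gamma> by simp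
    have "c (\<gamma> t) * (1 - t ^ 2) * (1 + norm (m (\<psi> (\<gamma> t))))
        \<le> c (\<psi> (\<gamma> t)) * (1 - norm (\<psi> (\<gamma> t)) ^ 2) * (1 + \<alpha>)"
      using interior[OF \<gamma>t] t norm_\<gamma> by simp
    also have "1 - norm (\<psi> (\<gamma> t)) ^ 2 = (1 + norm (\<psi> (\<gamma> t))) * (1 - norm (\<psi> (\<gamma> t)))"
      by (simp add: algebra_simps power2_eq_square)
    also have "c (\<psi> (\<gamma> t)) * ((1 + norm (\<psi> (\<gamma> t))) * (1 - norm (\<psi> (\<gamma> t)))) * (1 + \<alpha>)
        \<le> c (\<psi> (\<gamma> t)) * ((1 + norm (\<psi> (\<gamma> t))) * (q t * (1 - t))) * (1 + \<alpha>)"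
      using c_pos[OF less_imp_le[OF maps(1)[OF \<gamma>t]]] \<alpha> q
      by (intro mult_right_mono mult_left_mono) auto
    finally have "(c (\<gamma> t) * (1 + t) * (1 + norm (m (\<psi> (\<gamma> t))))) * (1 - t)
      \<le> (c (\<psi> (\<gamma> t)) * (1 + norm (\<psi> (\<gamma> t))) * q t * (1 + \<alpha>)) * (1 - t)"
      by (simp add: algebra_simps power2_eq_square)
    thus ?thesis using t by (simp add: mult_le_cancel_right)
  qed
  have "c a * (1 + 1) * (1 + norm (m a)) \<le> c a * (1 + norm a) * norm l * (1 + \<alpha>)"
  proof (rule tendsto_le)
    show "((\<lambda>t. c (\<gamma> t) * (1 + t) * (1 + norm (m (\<psi> (\<gamma> t)))))
        \<longlongrightarrow> c a * (1 + 1) * (1 + norm (m a))) (at_left 1)"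
      by (intro tendsto_intros c_lim \<gamma>_tendsto m_lim)
    show "((\<lambda>t. c (\<psi> (\<gamma> t)) * (1 + norm (\<psi> (\<gamma> t))) * q t * (1 + \<alpha>))
        \<longlongrightarrow> c a * (1 + norm a) * norm l * (1 + \<alpha>)) (at_left 1)"
      by (intro tendsto_intros c_lim \<psi>_lim q_lim)
    show "\<forall>\<^sub>F t in at_left 1. c (\<gamma> t) * (1 + t) * (1 + norm (m (\<psi> (\<gamma> t))))
      \<le> c (\<psi> (\<gamma> t)) * (1 + norm (\<psi> (\<gamma> t))) * q t * (1 + \<alpha>)"
      using unit by eventually_elim (rule radial; simp)
  qed simp
  moreover have "norm (m a) = 1"
    using m_identity[of a] a power2_eq_imp_eq[of "norm (m a)" 1] by simp
  ultimately have "2 \<le> norm l * (1 + \<alpha>)"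
    using c_pos[of a] a by simp
  moreover have "norm l * (1 + \<alpha>) < 2" if "norm l \<le> 1"
    using mult_right_mono[OF that, of "1 + \<alpha>"] \<alpha> by (simp only: mult_1) linarith
  ultimately show ?thesis by linarith
qed


section \<open>Self-maps of the closed disc that are analytic across the boundary\<close>

lemma analytic_on_cdisc_imp_continuous_on:
  assumes "analytic_on_cdisc \<phi>" shows "continuous_on cdisc \<phi>"
proof -
  obtain U g where "open U" "cdisc \<subseteq> U" "g analytic_on U" "\<And>z. z \<in> cdisc \<Longrightarrow> g z = \<phi> z"
    using assms unfolding analytic_on_cdisc_def by blast
  thus ?thesis
    by (metis analytic_imp_holomorphic continuous_on_cong continuous_on_subset
        holomorphic_on_imp_continuous_on)
qed

lemma analytic_on_cdisc_imp_holomorphic_on: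
  assumes "analytic_on_cdisc \<phi>" shows "\<phi> holomorphic_on udisc"
proof -
  obtain U g where "cdisc \<subseteq> U" "g analytic_on U" and eq: "\<And>z. z \<in> cdisc \<Longrightarrow> g z = \<phi> z"
    using assms unfolding analytic_on_cdisc_def by blast
  hence "g holomorphic_on udisc"
    using ball_subset_cball by (meson analytic_imp_holomorphic holomorphic_on_subset order_trans)
  thus ?thesis
    by (rule holomorphic_transform) (simp add: eq)
qed

lemma analytic_on_cdisc_funpow:
  assumes \<phi>: "analytic_on_cdisc \<phi>" and maps: "\<phi> ` cdisc \<subseteq> cdisc"
  shows "analytic_on_cdisc (\<phi> ^^ n)"
proof (induction n)
  case 0
  show ?case unfolding analytic_on_cdisc_def
    by (intro exI[of _ UNIV] exI[of _ "\<lambda>z. z"]) (auto intro: analytic_intros)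
next
  case (Suc n)
  obtain U g where U: "open U" "cdisc \<subseteq> U" "g analytic_on U" "\<And>z. z \<in> cdisc \<Longrightarrow> g z = \<phi> z"
    using \<phi> unfolding analytic_on_cdisc_def by blast
  obtain V h where V: "open V" "cdisc \<subseteq> V" "h analytic_on V" "\<And>z. z \<in> cdisc \<Longrightarrow> h z = (\<phi> ^^ n) z"
    using Suc unfolding analytic_on_cdisc_def by blast
  have maps_pow: "(\<phi> ^^ n) z \<in> cdisc" if "z \<in> cdisc" for z
    by (induction n) (use that maps in \<open>simp_all add: image_subset_iff\<close>)
  define W where "W = V \<inter> h -` U"
  have "open W" unfolding W_def
    by (intro continuous_open_preimage holomorphic_on_imp_continuous_on analytic_imp_holomorphic V U)
  moreover have "cdisc \<subseteq> W" using V(2) V(4) maps_pow subsetD[OF U(2)] by (auto simp: W_def simp del: mem_cball_0)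
  moreover have "(g \<circ> h) analytic_on W"
    by (rule analytic_on_compose_gen[OF analytic_on_subset[OF V(3)] U(3)]) (auto simp: W_def)
  moreover have "\<forall>z\<in>cdisc. (g \<circ> h) z = (\<phi> ^^ Suc n) z"
    using U(4) V(4) maps_pow by simp
  ultimately show ?case unfolding analytic_on_cdisc_def by blast
qed

lemma induces_endomorphism_funpow:
  assumes "induces_endomorphism M \<phi>" shows "induces_endomorphism M (\<phi> ^^ n)"
proof (induction n)
  case (Suc n)
  have "f \<circ> \<phi> ^^ Suc n = (f \<circ> \<phi>) \<circ> \<phi> ^^ n" for f :: "complex \<Rightarrow> complex"
    by (simp add: comp_assoc)
  thus ?case using assms Suc unfolding induces_endomorphism_def by metis
qed (simp add: induces_endomorphism_def comp_def)

lemma inner_functionI: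
  assumes \<phi>: "analytic_on_cdisc \<phi>" and le: "\<And>z. norm z \<le> 1 \<Longrightarrow> norm (\<phi> z) \<le> 1"
    and circle: "\<And>z. norm z = 1 \<Longrightarrow> norm (\<phi> z) = 1"
  shows "inner_function \<phi>"
  unfolding inner_function_def
proof (intro conjI ballI AE_I2)
  show "\<phi> analytic_on udisc"
    using analytic_on_cdisc_imp_holomorphic_on[OF \<phi>] by (simp add: analytic_on_open)
  show "norm (\<phi> z) \<le> 1" if "z \<in> udisc" for z using that le by simp
  fix t :: real
  have "((\<lambda>r. \<phi> (of_real r * cis t)) \<longlongrightarrow> \<phi> (cis t)) (at_left 1)"
  proof (rule continuous_on_tendsto_compose[OF analytic_on_cdisc_imp_continuous_on[OF \<phi>]])
    show "((\<lambda>r. of_real r * cis t) \<longlongrightarrow> cis t) (at_left 1)"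
      by (auto intro!: tendsto_eq_intros)
    show "\<forall>\<^sub>F r in at_left 1. of_real r * cis t \<in> cdisc"
      by (rule eventually_at_leftI[of 0]) (auto simp: norm_mult)
  qed simp
  moreover have "norm (\<phi> (cis t)) = 1" by (rule circle) simp
  ultimately show "\<exists>l. ((\<lambda>r. \<phi> (of_real r * cis t)) \<longlongrightarrow> l) (at_left 1) \<and> norm l = 1"
    by blast
qed

lemma maps_udisc_to_udisc:
  assumes hol: "\<phi> holomorphic_on udisc" and le: "\<And>z. norm z < 1 \<Longrightarrow> norm (\<phi> z) \<le> 1"
    and b: "norm b < 1" "norm (\<phi> b) < 1" and z: "norm z < 1"
  shows "norm (\<phi> z) < 1"
proof (rule ccontr)
  assume "\<not> norm (\<phi> z) < 1"
  hence max: "norm (\<phi> w) \<le> norm (\<phi> z)" if "norm w < 1" for w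
    using le[OF that] by linarith
  have "\<phi> constant_on udisc"
    by (rule maximum_modulus_principle[OF hol, of udisc z]) (use z max in auto)
  hence "\<phi> z = \<phi> b" using z b unfolding constant_on_def by (metis mem_ball_0)
  with b \<open>\<not> norm (\<phi> z) < 1\<close> show False by simp
qed

theorem theorem8:
  fixes M :: "nat \<Rightarrow> real" and \<phi> :: "complex \<Rightarrow> complex" and N :: nat
  assumes "nonanalytic_weight M"
    and "analytic_on_cdisc \<phi>"
    and "\<phi> ` cdisc \<subseteq> cdisc"
    and "\<phi> \<in> D_space M"
    and "\<not> inner_function \<phi>"
    and "\<exists>z\<in>udisc. \<phi> z = z"
    and "N > 0" and "\<exists>z\<in>cdisc - udisc. (\<phi> ^^ N) z = z"
  shows "\<not> induces_endomorphism M \<phi>"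
proof -
  define \<psi> where "\<psi> = \<phi> ^^ N"
  have M_pos: "M n > 0" for n
    using assms(1) by (simp add: nonanalytic_weight_def weight_sequence_def)
  have \<phi>_le: "norm (\<phi> z) \<le> 1" if "norm z \<le> 1" for z
    using imageI[of z cdisc \<phi>] assms(3) that by (auto simp: subset_iff)
  obtain b where b: "norm b < 1" "\<phi> b = b" using assms(6) by auto
  obtain a where a: "norm a = 1" "\<psi> a = a" using assms(8) by (auto simp: \<psi>_def)
  obtain \<zeta> where \<zeta>: "norm \<zeta> = 1" "norm (\<phi> \<zeta>) < 1"
    using inner_functionI[OF assms(2) \<phi>_le] assms(5) \<phi>_le by (metis order_le_less)
  have \<phi>_lt: "norm (\<phi> z) < 1" if "norm z < 1" for z
    by (rule maps_udisc_to_udisc[OF analytic_on_cdisc_imp_holomorphic_on[OF assms(2)] _ _ _ that])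
       (use \<phi>_le b in auto)
  have pow_le: "norm ((\<phi> ^^ n) z) \<le> 1" if "norm z \<le> 1" for z n
    by (induction n) (use that \<phi>_le in auto)
  have pow_lt: "norm ((\<phi> ^^ n) z) < 1" if "norm z < 1" for z n
    by (induction n) (use that \<phi>_lt in auto)
  have pow_b: "(\<phi> ^^ n) b = b" for n
    by (induction n) (use b in auto)
  \<comment> \<open>The first step moves \<open>\<zeta>\<close> into the open disc, where the orbit remains.\<close>
  obtain k where "N = Suc k" using assms(7) gr0_implies_Suc by blast
  hence \<psi>_\<zeta>: "norm (\<psi> \<zeta>) < 1"
    using pow_lt[OF \<zeta>(2), of k] by (simp add: \<psi>_def funpow_Suc_right del: funpow.simps)
  have \<psi>: "analytic_on_cdisc \<psi>"
    unfolding \<psi>_def by (rule analytic_on_cdisc_funpow[OF assms(2,3)])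
  then obtain U g where "open U" "cdisc \<subseteq> U" "g analytic_on U" "\<And>z. z \<in> cdisc \<Longrightarrow> g z = \<psi> z"
    unfolding analytic_on_cdisc_def by blast
  then interpret analytic_disc_map U g \<psi>
    using pow_le by unfold_locales (auto simp: analytic_imp_holomorphic \<psi>_def)
  have "norm (deriv g a) > 1"
  proof (rule boundary_fixed_point_repelling[OF _ _ _ _ b(1) _ a \<zeta>(1) \<psi>_\<zeta>])
    show "(\<psi> has_field_derivative deriv g a) (at a within cdisc)"
      using a by (intro has_field_derivative_within) simp
    show "continuous_on cdisc \<psi>" by (rule analytic_on_cdisc_imp_continuous_on[OF \<psi>])
    show "\<psi> holomorphic_on udisc" by (rule analytic_on_cdisc_imp_holomorphic_on[OF \<psi>])
  qed (auto simp: \<psi>_def pow_lt pow_le pow_b)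
  hence "\<not> induces_endomorphism M \<psi>"
    using a by (intro repelling_fixed_point_not_endomorphism[OF M_pos]) auto
  thus ?thesis using induces_endomorphism_funpow unfolding \<psi>_def by blast
qed

end
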